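(* Let $p=s/t\le 1/2$, $a=\frac{2s-t}{s}$, $a_1=|2s-t|=t-2s$ and $a_2=s$. (If $p=1/2$ we obtain $a=0$, $a_1=0$, $a_2=1$.) 1. Suppose $pd$ is not an integer. (a) If $pd+p<j^m$, there are $\alpha_i,\beta_i\in\{0,1\}^{d-1}$ with $|\alpha_i|=j^M$ and $|\beta_i|=j^m$ such that the polynomial $$P_{d-j^M}(x)=-a_2\prod_{i=1}^{d-j^M}x_i+\sum_{i=1}^{h}x^{\alpha_i}+\sum_{i=1}^{k}x^{\beta_i}-a_1,$$ where $k=a_2d-2a_2j^M-a_1j^M$ and $h=a_1+a_2-k$, belongs to the ideal $\mathcal{I}_{\mathcal{P}}$, and the corresponding $X\in\mathcal{F}_d(p)$ has sum $S^*=\sum_{i=1}^dX_i$ with support on $\{j^M,j^m\}$. (b) If $pd+p\ge j^m$, there are $\alpha_i,\beta_i\in\{0,1\}^{d-1}$ with $|\alpha_i|=j^M$ and $|\beta_i|=j^m$ such that the polynomial $$P_{d-j^m}(x)=-a_2\prod_{i=1}^{d-j^m}x_i+\sum_{i=1}^{h}x^{\alpha_i}+\sum_{i=1}^{k}x^{\beta_i}-a_1,$$ where $k=a_2d-2a_2j^M-a_1j^M-a_2$ and $h=a_1+a_2-k$, belongs to the ideal $\mathcal{I}_{\mathcal{P}}$, and the corresponding $X\in\mathcal{F}_d(p)$ has sum $S^*=\sum_{i=1}^dX_i$ with support on $\{j^M,j^m\}$. 2. If $pd$ is an integer, there are $\alpha_i\in\{0,1\}^{d-1}$ with $|\alpha_i|=pd$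 such that the polynomial $$P_{pd}(x)=-a_2\prod_{i=1}^{d-pd}x_i+\sum_{i=1}^{a_1+a_2}x^{\alpha_i}-a_1$$ belongs to the ideal $\mathcal{I}_{\mathcal{P}}$, and the corresponding $X\in\mathcal{F}_d(p)$ has sum with support on $\{pd\}$. Here the $X\in\mathcal{F}_d(p)$ corresponding to a polynomial is the random vector whose pmf is the type-0 pmf associated with that polynomial.
   Context: Let $d\ge 2$, $D=2^d$, and let $p=s/t\in\mathbb{Q}$ with positive integers $s,t$ and $0<p\le 1/2$ (for $p=1/2$: $s=1$, $t=2$); put $c=(1-p)/p=(t-s)/s$. $j^M$ is the largest integer less than $pd$ and $j^m$ the smallest integer greater than $pd$. For a binary vector $\alpha$, $|\alpha|$ is the number of its nonzero entries, and $x^\alpha=x_1^{\alpha_1}\cdots x_{d-1}^{\alpha_{d-1}}$ for $\alpha\in\{0,1\}^{d-1}$. $\mathcal{F}_d(p)$ is the set of probability mass functions (pmfs) on $\{0,1\}^d$ all of whose univariate marginals are Bernoulli with parameter $p$; one also writes $X\in\mathcal{F}_d(p)$ for a random vector $X=(X_1,\ldots,X_d)$ with pmf in $\mathcal{F}_d(p)$. A pmf is identified with the vector $f=(f_1,\ldots,f_D)$, where $f_i$ is the probability of the point $(x_1,\ldots,x_d)\in\{0,1\}^d$ with $i=1+\sum_{k=1}^d x_k2^{k-1}$. $\mathcal{I}_{\mathcal{P}}\subseteq\mathbb{Q}[x_1,\ldots,x_{d-1}]$ is the ideal of polynomials vanishing at $(1,\ldots,1)$ and at $c_j=(1,\ldots,1,-c,1,\ldots,1)$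 ($-c$ in position $j$), $j=1,\ldots,d-1$. Type-0 pmf: for $1\le j\le D/2$ let $m_j(x)=\prod_{k=1}^{d-1}x_k^{\varepsilon_k}$, where $\varepsilon_k\in\{0,1\}$ and $j=1+\sum_{k=1}^{d-1}\varepsilon_k2^{k-1}$. Given $P=\sum_{j=1}^{D/2}b_jm_j(x)\in\mathcal{I}_{\mathcal{P}}$, the type-0 pmf $f=(f_1,\ldots,f_D)\in\mathcal{F}_d(p)$ associated with $P$ is obtained as follows. (1) For each $j=2,\ldots,D/2$: if $b_j\ge0$ then $f_j=b_j$ and $f_{D+1-j}=0$; if $b_j<0$ then $f_j=0$ and $f_{D+1-j}=-b_j$. (2) Let $c_0=b_1+\frac{2s-t}{s}\sum_{2\le j\le D/2,\ b_j<0}b_j$; if $c_0\ge0$ then $f_1=c_0$ and $f_D=0$; if $c_0<0$ then $f_1=0$ and $f_D=-c_0/c$. (3) Normalize: replace $f$ by $f/\sum_{j=1}^Df_j$.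
   Formalization: In 1(a) j^M≥1 is assumed (else x_d, not a ring variable, occurs); the claims on X are made only if j^m<d-j^M in 1(a), j^m<d-j^m in 1(b), pd<d-pd in 2 (so never for p=1/2), as otherwise cancellation makes P zero or gives X the wrong support. *)

theory Defs
  imports "HOL-Probability.Probability" "HOL-Library.Poly_Mapping" "HOL-Library.FuncSet"
begin

text \<open>
  Polynomials over the rationals are finitely supported maps from exponent vectors to
  coefficients, with the convolution product of \<^theory>\<open>HOL-Library.Poly_Mapping\<close>.  The variables
  are indexed by all natural numbers; \<open>\<rat>[x\<^sub>1, \<dots>, x\<^sub>n]\<close> is carved out by \<open>poly_ring\<close>.
\<close>

type_synonym qpoly = "(nat \<Rightarrow>\<^sub>0 nat) \<Rightarrow>\<^sub>0 rat"

definition pvar :: "nat \<Rightarrow> qpoly" where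
  "pvar k = Poly_Mapping.single (Poly_Mapping.single k 1) 1"

definition pconst :: "rat \<Rightarrow> qpoly" where
  "pconst a = Poly_Mapping.single 0 a"

definition peval :: "(nat \<Rightarrow> rat) \<Rightarrow> qpoly \<Rightarrow> rat" where
  "peval x P = (\<Sum>m\<in>Poly_Mapping.keys P. Poly_Mapping.lookup P m * (\<Prod>k\<in>Poly_Mapping.keys m. x k ^ Poly_Mapping.lookup m k))"

definition poly_ring :: "nat \<Rightarrow> qpoly set" where
  "poly_ring n = {P. \<forall>m\<in>Poly_Mapping.keys P. Poly_Mapping.keys m \<subseteq> {1..n}}"

text \<open>\<open>cube n\<close> is \<open>{0,1}\<^sup>n\<close> with coordinates indexed by \<open>1, \<dots>, n\<close>.\<close>

definition cube :: "nat \<Rightarrow> (nat \<Rightarrow> nat) set" where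
  "cube n = {1..n} \<rightarrow>\<^sub>E {0, 1}"

definition weight :: "nat \<Rightarrow> (nat \<Rightarrow> nat) \<Rightarrow> nat" where
  "weight n \<alpha> = card {k \<in> {1..n}. \<alpha> k \<noteq> 0}"

definition xpow :: "nat \<Rightarrow> (nat \<Rightarrow> nat) \<Rightarrow> qpoly" where
  "xpow n \<alpha> = (\<Prod>k=1..n. pvar k ^ \<alpha> k)"

definition c_of :: "nat \<Rightarrow> nat \<Rightarrow> rat" where
  "c_of s t = (of_nat t - of_nat s) / of_nat s"

text \<open>The ideal \<open>\<I>\<^sub>\<P>\<close> for dimension \<open>d\<close> and \<open>p = s/t\<close>.\<close>

definition ideal_P :: "nat \<Rightarrow> nat \<Rightarrow> nat \<Rightarrow> qpoly set" where
  "ideal_P d s t = {P \<in> poly_ring (d - 1).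
     peval (\<lambda>_. 1) P = 0 \<and>
     (\<forall>j\<in>{1..d - 1}. peval (\<lambda>k. if k = j then - c_of s t else 1) P = 0)}"

definition bernoulli_class :: "nat \<Rightarrow> real \<Rightarrow> (nat \<Rightarrow> nat) pmf set" where
  "bernoulli_class d p = {X. set_pmf X \<subseteq> cube d \<and>
     (\<forall>k\<in>{1..d}. map_pmf (\<lambda>x. x k = 1) X = bernoulli_pmf p)}"

definition point_index :: "nat \<Rightarrow> (nat \<Rightarrow> nat) \<Rightarrow> nat" where
  "point_index d x = 1 + (\<Sum>k=1..d. x k * 2 ^ (k - 1))"

text \<open>
  \<open>mono_j d j\<close> is the monomial \<open>m\<^sub>j\<close>: the exponent of \<open>x\<^sub>k\<close> is the binary digit of \<open>j - 1\<close> at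
  position \<open>k - 1\<close>.
\<close>

definition mono_j :: "nat \<Rightarrow> nat \<Rightarrow> qpoly" where
  "mono_j d j = (\<Prod>k=1..d - 1. pvar k ^ of_bool (bit (j - 1) (k - 1)))"

definition type0_c0 :: "nat \<Rightarrow> nat \<Rightarrow> nat \<Rightarrow> (nat \<Rightarrow> rat) \<Rightarrow> rat" where
  "type0_c0 d s t b = b 1 + (2 * of_nat s - of_nat t) / of_nat s *
     (\<Sum>j | 2 \<le> j \<and> j \<le> 2 ^ d div 2 \<and> b j < 0. b j)"

text \<open>
  The vector \<open>(f\<^sub>1, \<dots>, f\<^sub>D)\<close>, \<open>D = 2\<^sup>d\<close>, before normalization.  The positions \<open>i > D/2\<close> other than
  \<open>D\<close> are those of the form \<open>D + 1 - j\<close> with \<open>2 \<le> j \<le> D/2\<close>.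
\<close>

definition type0_raw :: "nat \<Rightarrow> nat \<Rightarrow> nat \<Rightarrow> (nat \<Rightarrow> rat) \<Rightarrow> nat \<Rightarrow> rat" where
  "type0_raw d s t b i =
    (let D = 2 ^ d; c0 = type0_c0 d s t b in
     if i = 1 then (if c0 \<ge> 0 then c0 else 0)
     else if i = D then (if c0 \<ge> 0 then 0 else - c0 / c_of s t)
     else if i \<le> D div 2 then (if b i \<ge> 0 then b i else 0)
     else (if b (D + 1 - i) \<ge> 0 then 0 else - b (D + 1 - i)))"

definition type0_vec :: "nat \<Rightarrow> nat \<Rightarrow> nat \<Rightarrow> (nat \<Rightarrow> rat) \<Rightarrow> nat \<Rightarrow> rat" where
  "type0_vec d s t b i = type0_raw d s t b i / (\<Sum>j=1..2 ^ d. type0_raw d s t b j)"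

text \<open>
  \<open>X\<close> is the type-0 pmf associated with \<open>P\<close>.  The \<open>b\<^sub>j\<close> are the coefficients of \<open>P\<close> after collecting
  equal monomials, so they are determined by \<open>P\<close> on \<open>{1..D/2}\<close>.  For \<open>P = 0\<close> the construction is
  \<open>0/0\<close> and no pmf is associated: the vector is then \<open>0\<close>.
\<close>

definition is_type0_pmf :: "nat \<Rightarrow> nat \<Rightarrow> nat \<Rightarrow> qpoly \<Rightarrow> (nat \<Rightarrow> nat) pmf \<Rightarrow> bool" where
  "is_type0_pmf d s t P X \<longleftrightarrow>
     P \<in> ideal_P d s t \<and>
     set_pmf X \<subseteq> cube d \<and>
     (\<exists>b. P = (\<Sum>j=1..2 ^ d div 2. pconst (b j) * mono_j d j) \<and>
          (\<forall>x\<in>cube d. pmf X x = of_rat (type0_vec d s t b (point_index d x))))"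

text \<open>The distribution of \<open>X\<^sub>1 + \<dots> + X\<^sub>d\<close>.\<close>

definition sum_pmf :: "nat \<Rightarrow> (nat \<Rightarrow> nat) pmf \<Rightarrow> nat pmf" where
  "sum_pmf d X = map_pmf (\<lambda>x. \<Sum>k=1..d. x k) X"

text \<open>
  The polynomials of the theorem,
  \<open>- a\<^sub>2 x\<^sub>1 \<cdots> x\<^sub>n + (\<Sum>i=1..h. x\<^bsup>\<alpha>\<^sub>i\<^esup>) + (\<Sum>i=1..k. x\<^bsup>\<beta>\<^sub>i\<^esup>) - a\<^sub>1\<close>,
  with \<open>n \<le> d - 1\<close>.  Membership in the ideal forces every \<open>\<alpha>\<^sub>i\<close>, \<open>\<beta>\<^sub>i\<close> of positive weight to be supported
  in \<open>{1..n}\<close>, so one of weight \<open>n\<close> gives the monomial \<open>x\<^sub>1 \<cdots> x\<^sub>n\<close> itself.  Its coefficient then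
  partly or fully cancels \<open>- a\<^sub>2\<close> and the type-0 pmf of the sum no longer has the intended support
  (for \<open>d = 2\<close>, \<open>p = 1/2\<close> the polynomial is \<open>- x\<^sub>1 + x\<^sub>1 = 0\<close>).  This is why the theorem claims the
  pmf part only when \<open>n\<close> exceeds all the prescribed weights.  Likewise the case \<open>n = d\<close> is excluded,
  as \<open>x\<^sub>d\<close> is not a variable of \<open>\<rat>[x\<^sub>1, \<dots>, x\<^bsub>d-1\<^esub>]\<close>.
\<close>

definition poly_S :: "nat \<Rightarrow> int \<Rightarrow> int \<Rightarrow> nat \<Rightarrow> nat \<Rightarrow> nat \<Rightarrow> (nat \<Rightarrow> nat \<Rightarrow> nat) \<Rightarrow>
    (nat \<Rightarrow> nat \<Rightarrow> nat) \<Rightarrow> qpoly" where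
  "poly_S d a1 a2 n h k \<alpha> \<beta> =
     - of_int a2 * (\<Prod>i=1..n. pvar i) + (\<Sum>i=1..h. xpow (d - 1) (\<alpha> i))
       + (\<Sum>i=1..k. xpow (d - 1) (\<beta> i)) - of_int a1"

end

(*
  A monomial x^A takes the value 1 at (1,...,1) and 1 - (t/s)[j in A] at c_j. Hence
  sum_i x^(A_i) - s x_1...x_n - (t - 2s), with t - s sets A_i, lies in the ideal iff every
  j <= n is contained in exactly s of the A_i and no j > n is contained in any of them. Sets
  with prescribed sizes w_i <= n, sum_i w_i = s n, and this covering property come from dealing
  out 1,...,n cyclically. The type-0 pmf of the polynomial is the uniform distribution on the t
  points consisting of the A_i and s copies of the complement of {1..n} in {1..d}. So its
  sum takes the values w_i and d - n, and the theorem reduces to checking the size equations.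
*)

theory Submission
  imports Defs "HOL-Library.Nat_Bijection"
begin

subsection \<open>Subsets, binary vectors and their indices\<close>

text \<open>The numbers in the theorem are forced by counting incidences. The t points have total
  size s d, of which the s copies of the complement take s (d - n). Giving the complement size
  \<open>jM\<close> leaves k = s d - t jM sets of size \<open>jm\<close>; this is positive because
  jM < p d, and it is below t - s exactly when p d + p < jm. If that fails, the complement gets size
  \<open>jm\<close> instead, which lowers k by s and, since p \<le> 1/2, keeps it nonnegative. The
  bound p \<le> 1/2 also makes the sizes that actually occur fit into {1..n}. The remaining
  difficulty is that the sets may coincide: the type-0 recipe acts on collected coefficients, so the
  comparison with the uniform distribution is one of multiplicities.\<close>

definition ind_vec :: "nat \<Rightarrow> nat set \<Rightarrow> nat \<Rightarrow> nat" where
  "ind_vec m A = (\<lambda>k\<in>{1..m}. of_bool (k \<in> A))"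

text \<open>No dimension enters, so the same number indexes a monomial in d - 1 variables and the
  point of the d-cube with the same support and last coordinate 0.\<close>

definition set_index :: "nat set \<Rightarrow> nat" where
  "set_index A = 1 + (\<Sum>k\<in>A. 2 ^ (k - 1))"

definition index_set :: "nat \<Rightarrow> nat set" where
  "index_set j = Suc ` set_decode (j - 1)"

lemma ind_vec_in_cube: "ind_vec m A \<in> cube m"
  by (auto simp: ind_vec_def cube_def)

lemma ind_vec_apply: "k \<in> {1..m} \<Longrightarrow> ind_vec m A k = of_bool (k \<in> A)"
  by (simp add: ind_vec_def)

lemma cube_eq_ind_vec:
  assumes "x \<in> cube m"
  shows "x = ind_vec m {k \<in> {1..m}. x k = 1}"
proof
  fix k
  show "x k = ind_vec m {k \<in> {1..m}. x k = 1} k"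
    using assms by (cases "k \<in> {1..m}") (auto simp: ind_vec_def cube_def PiE_def extensional_def Pi_def)
qed

lemma ind_vec_inject:
  assumes "A \<subseteq> {1..m}" "B \<subseteq> {1..m}"
  shows "ind_vec m A = ind_vec m B \<longleftrightarrow> A = B"
proof
  assume eq: "ind_vec m A = ind_vec m B"
  have "k \<in> A \<longleftrightarrow> k \<in> B" if "k \<in> {1..m}" for k
    using fun_cong[OF eq, of k] that by (simp only: ind_vec_apply of_bool_eq_iff)
  then show "A = B" using assms by blast
qed auto

lemma weight_ind_vec:
  assumes "A \<subseteq> {1..m}"
  shows "weight m (ind_vec m A) = card A"
proof -
  have "{k \<in> {1..m}. ind_vec m A k \<noteq> 0} = A"
    using assms by (auto simp: ind_vec_apply)
  then show ?thesis by (simp add: weight_def)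
qed

lemma sum_ind_vec:
  assumes "A \<subseteq> {1..m}"
  shows "(\<Sum>k=1..m. ind_vec m A k) = card A"
proof -
  have "(\<Sum>k=1..m. ind_vec m A k) = (\<Sum>k=1..m. of_bool (k \<in> A))"
    by (intro sum.cong) (auto simp: ind_vec_apply)
  also have "\<dots> = card ({1..m} \<inter> A)"
    by (simp add: sum.inter_restrict[symmetric] of_bool_def if_distrib)
  finally show ?thesis using assms by (simp add: Int_absorb1)
qed

lemma point_index_ind_vec:
  assumes "A \<subseteq> {1..m}"
  shows "point_index m (ind_vec m A) = set_index A"
proof -
  have "(\<Sum>k=1..m. ind_vec m A k * 2 ^ (k - 1)) = (\<Sum>k=1..m. if k \<in> A then 2 ^ (k - 1) else 0)"
    by (intro sum.cong) (auto simp: ind_vec_apply)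
  also have "\<dots> = (\<Sum>k\<in>A. 2 ^ (k - 1))"
    using assms by (simp add: sum.inter_restrict[symmetric] Int_absorb1)
  finally show ?thesis by (simp add: point_index_def set_index_def)
qed

lemma set_index_index_set:
  assumes "j \<ge> 1"
  shows "set_index (index_set j) = j"
proof -
  have "(\<Sum>k\<in>index_set j. 2 ^ (k - 1)) = set_encode (set_decode (j - 1))"
    by (simp add: index_set_def sum.reindex set_encode_def)
  then show ?thesis using assms by (simp add: set_index_def)
qed

lemma index_set_set_index:
  assumes "A \<subseteq> {1..m}"
  shows "index_set (set_index A) = A"
proof -
  let ?B = "(\<lambda>k. k - 1) ` A"
  \<comment> \<open>Truncated subtraction identifies 0 and 1, so injectivity rests on 0 \<notin>
    A.\<close>
  have inj: "inj_on (\<lambda>k. k - 1) A"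
    using assms by (auto simp: inj_on_def subset_iff) (metis Suc_pred' One_nat_def Suc_le_lessD)
  have fin: "finite A" using assms finite_subset by blast
  have "set_index A = 1 + set_encode ?B"
    unfolding set_index_def set_encode_def sum.reindex[OF inj] by simp
  then have "index_set (set_index A) = Suc ` ?B"
    using fin by (simp add: index_set_def)
  also have "\<dots> = A"
    using assms by (force simp: image_image)
  finally show ?thesis .
qed

lemma set_index_inject:
  assumes "A \<subseteq> {1..m}" "B \<subseteq> {1..m}"
  shows "set_index A = set_index B \<longleftrightarrow> A = B"
  using assms index_set_set_index by metis

lemma set_index_full: "set_index {1..m} = 2 ^ m"
proof -
  have "(\<Sum>k=1..m. 2 ^ (k - 1)) = (2 ^ m - 1 :: nat)"
    by (induction m) auto
  then show ?thesis by (simp add: set_index_def)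
qed

text \<open>All the powers 2^0, ..., 2^(m-1) add up to 2^m - 1. Consequently the type-0 positions j
  and D + 1 - j belong to complementary points.\<close>

lemma set_index_compl:
  assumes "A \<subseteq> {1..m}"
  shows "set_index A + set_index ({1..m} - A) = 2 ^ m + 1"
proof -
  have "(\<Sum>k\<in>{1..m} - A. 2 ^ (k - 1)) + (\<Sum>k\<in>A. 2 ^ (k - 1)) = (\<Sum>k=1..m. 2 ^ (k - 1) :: nat)"
    using assms by (intro sum.subset_diff[symmetric]) auto
  then show ?thesis using set_index_full[of m] by (simp add: set_index_def)
qed

lemma set_index_ge: "set_index A \<ge> 1" by (simp add: set_index_def)

lemma set_index_le: "A \<subseteq> {1..m} \<Longrightarrow> set_index A \<le> 2 ^ m"
  using set_index_compl[of A m] set_index_ge[of "{1..m} - A"] by linarith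

text \<open>The largest element contributes as much as all smaller ones together plus one. Thus the
  two halves of the type-0 vector are told apart by the last coordinate.\<close>

lemma set_index_le_half_iff:
  assumes "A \<subseteq> {1..Suc m}"
  shows "set_index A \<le> 2 ^ m \<longleftrightarrow> Suc m \<notin> A"
proof
  assume le: "set_index A \<le> 2 ^ m"
  show "Suc m \<notin> A"
  proof
    assume "Suc m \<in> A"
    then have "(2::nat) ^ (Suc m - 1) \<le> (\<Sum>k\<in>A. 2 ^ (k - 1))"
      using assms finite_subset by (intro member_le_sum) auto
    then show False using le by (simp add: set_index_def)
  qed
next
  assume "Suc m \<notin> A"
  with assms have "A \<subseteq> {1..m}" using le_Suc_eq by fastforce
  then show "set_index A \<le> 2 ^ m" by (rule set_index_le)
qed

lemma index_set_subset:
  assumes "j \<ge> 1" "j \<le> 2 ^ m"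
  shows "index_set j \<subseteq> {1..m}"
proof -
  have "x < m" if "x \<in> set_decode (j - 1)" for x
  proof (rule ccontr)
    assume "\<not> x < m"
    then have "(2::nat) ^ m \<le> 2 ^ x" by simp
    then have "(j - 1) div 2 ^ x = 0" using assms by (intro div_less) linarith
    then show False using that by (simp add: set_decode_def)
  qed
  then show ?thesis by (auto simp: index_set_def Suc_le_eq)
qed

lemma bij_betw_set_index: "bij_betw set_index (Pow {1..m}) {1..2 ^ m}"
proof (rule bij_betw_byWitness[where f' = index_set])
  show "set_index ` Pow {1..m} \<subseteq> {1..2 ^ m}"
    using set_index_ge set_index_le by (simp add: image_subset_iff)
  show "index_set ` {1..2 ^ m} \<subseteq> Pow {1..m}"
    using index_set_subset by (simp add: image_subset_iff)
qed (simp_all add: index_set_set_index set_index_index_set)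

subsection \<open>Square-free monomials and evaluation\<close>

abbreviation varprod :: "nat set \<Rightarrow> qpoly" where
  "varprod A \<equiv> \<Prod>k\<in>A. pvar k"

definition expo :: "nat set \<Rightarrow> nat \<Rightarrow>\<^sub>0 nat" where
  "expo A = (\<Sum>k\<in>A. Poly_Mapping.single k 1)"

lemma lookup_expo: "finite A \<Longrightarrow> Poly_Mapping.lookup (expo A) k = of_bool (k \<in> A)"
  by (simp add: expo_def lookup_sum lookup_single when_def sum.delta' of_bool_def)

lemma keys_expo: "finite A \<Longrightarrow> Poly_Mapping.keys (expo A) = A"
  by (auto simp: in_keys_iff lookup_expo)

lemma varprod_eq_single: "finite A \<Longrightarrow> varprod A = Poly_Mapping.single (expo A) 1"
proof (induction rule: finite_induct)
  case (insert k A)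
  then show ?case by (simp add: pvar_def mult_single expo_def)
qed (simp add: expo_def)

lemma xpow_ind_vec:
  assumes "A \<subseteq> {1..m}"
  shows "xpow m (ind_vec m A) = varprod A"
proof -
  have "xpow m (ind_vec m A) = (\<Prod>k=1..m. if k \<in> A then pvar k else 1)"
    unfolding xpow_def by (intro prod.cong) (auto simp: ind_vec_apply)
  also have "\<dots> = varprod A"
    using assms by (simp add: prod.inter_restrict[symmetric] Int_absorb1)
  finally show ?thesis .
qed

lemma mono_j_eq_varprod:
  assumes "j \<ge> 1" "j \<le> 2 ^ (d - 1)"
  shows "mono_j d j = varprod (index_set j)"
proof -
  have bit: "bit (j - 1) (k - 1) \<longleftrightarrow> k \<in> index_set j" if "k \<ge> 1" for k
  proof -
    have "k \<in> index_set j \<longleftrightarrow> k - 1 \<in> set_decode (j - 1)"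
      using that by (cases k) (auto simp: index_set_def)
    then show ?thesis by (simp add: set_decode_def bit_iff_odd)
  qed
  have "mono_j d j = (\<Prod>k=1..d-1. if k \<in> index_set j then pvar k else 1)"
    unfolding mono_j_def by (intro prod.cong) (auto simp: bit[unfolded One_nat_def])
  also have "\<dots> = varprod (index_set j)"
    using index_set_subset[OF assms] by (simp add: prod.inter_restrict[symmetric] Int_absorb1)
  finally show ?thesis .
qed

text \<open>Outside the support the coefficients are 0. A common index set is needed for additivity,
  since cancellation can make the support of a sum smaller than the union of the supports.\<close>

lemma peval_superset:
  assumes "finite S" "Poly_Mapping.keys P \<subseteq> S"
  shows "peval x P = (\<Sum>m\<in>S. Poly_Mapping.lookup P m *
           (\<Prod>k\<in>Poly_Mapping.keys m. x k ^ Poly_Mapping.lookup m k))"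
  unfolding peval_def using assms by (intro sum.mono_neutral_left) (auto simp: in_keys_iff)

lemma peval_add: "peval x (P + Q) = peval x P + peval x Q"
proof -
  let ?S = "Poly_Mapping.keys P \<union> Poly_Mapping.keys Q"
  have "finite ?S" "Poly_Mapping.keys (P + Q) \<subseteq> ?S"
    by (simp_all add: keys_add)
  then show ?thesis
    by (simp add: peval_superset[of ?S] lookup_add distrib_right sum.distrib)
qed

lemma peval_0 [simp]: "peval x 0 = 0"
  by (simp add: peval_def)

lemma peval_diff: "peval x (P - Q) = peval x P - peval x Q"
  using peval_add[of x "P - Q" Q] by simp

lemma peval_sum: "peval x (\<Sum>i\<in>I. P i) = (\<Sum>i\<in>I. peval x (P i))"
  by (induction I rule: infinite_finite_induct) (simp_all add: peval_add)

lemma peval_single: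
  "peval x (Poly_Mapping.single m a) =
     a * (\<Prod>k\<in>Poly_Mapping.keys m. x k ^ Poly_Mapping.lookup m k)"
  by (simp add: peval_def)

lemma pconst_mult_varprod:
  "finite A \<Longrightarrow> pconst a * varprod A = Poly_Mapping.single (expo A) a"
  by (simp add: pconst_def varprod_eq_single mult_single)

lemma peval_pconst_mult_varprod:
  assumes "finite A"
  shows "peval x (pconst a * varprod A) = a * (\<Prod>k\<in>A. x k)"
  by (simp add: pconst_mult_varprod assms peval_single keys_expo lookup_expo)

lemma poly_ring_pconst_mult_varprod:
  "A \<subseteq> {1..m} \<Longrightarrow> pconst a * varprod A \<in> poly_ring m"
  using finite_subset[of A "{1..m}"] by (auto simp: poly_ring_def pconst_mult_varprod keys_expo subset_iff split: if_splits)

lemma poly_ring_add: "P \<in> poly_ring m \<Longrightarrow> Q \<in> poly_ring m \<Longrightarrow> P + Q \<in> poly_ring m"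
  using keys_add[of P Q] unfolding poly_ring_def by blast

lemma poly_ring_diff: "P \<in> poly_ring m \<Longrightarrow> Q \<in> poly_ring m \<Longrightarrow> P - Q \<in> poly_ring m"
  using keys_diff[of P Q] unfolding poly_ring_def by blast

lemma poly_ring_0: "0 \<in> poly_ring m"
  by (simp add: poly_ring_def)

lemma poly_ring_sum: "(\<And>i. i \<in> I \<Longrightarrow> P i \<in> poly_ring m) \<Longrightarrow> (\<Sum>i\<in>I. P i) \<in> poly_ring m"
  by (induction I rule: infinite_finite_induct) (simp_all add: poly_ring_add poly_ring_0)

lemma pconst_1: "pconst 1 = 1"
  by (simp add: pconst_def)

lemma pconst_of_nat: "pconst (of_nat a) = of_nat a"
  by (simp add: pconst_def)

lemma pconst_0: "pconst 0 = 0"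
  by (simp add: pconst_def)

lemma pconst_diff: "pconst (a - b) = pconst a - pconst b"
  by (simp add: pconst_def single_diff)

subsection \<open>Balanced families of sets\<close>

text \<open>Round robin: the \<open>i\<close>-th set takes the next \<open>w i\<close> residues modulo \<open>n\<close>.\<close>

lemma round_robin:
  fixes w :: "nat \<Rightarrow> nat"
  assumes n: "n > 0" and w: "\<And>i. i < N \<Longrightarrow> w i \<le> n"
  shows "\<exists>A. (\<forall>i<N. A i \<subseteq> {1..n} \<and> card (A i) = w i) \<and>
    (\<forall>j. card {i. i < N \<and> j \<in> A i} = card {q. q < (\<Sum>i<N. w i) \<and> Suc (q mod n) = j})"
  using w
proof (induction N)
  case 0
  then show ?case by simp
next
  case (Suc N)
  then obtain A where A: "\<forall>i<N. A i \<subseteq> {1..n} \<and> card (A i) = w i"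
    and cnt: "\<forall>j. card {i. i < N \<and> j \<in> A i} = card {q. q < (\<Sum>i<N. w i) \<and> Suc (q mod n) = j}"
    by force
  define S where "S = (\<Sum>i<N. w i)"
  define B where "B = (\<lambda>q. Suc (q mod n)) ` {S..<S + w N}"
  have inj: "inj_on (\<lambda>q. Suc (q mod n)) {S..<S + w N}"
  proof (rule linorder_inj_onI')
    fix q r assume qr: "q \<in> {S..<S + w N}" "r \<in> {S..<S + w N}" "q < r"
    \<comment> \<open>Two positions of the same block differ by less than \<open>w N\<close> \<le>
      n, so they are dealt different elements and the block yields a set of full size.\<close>
    have "\<not> n dvd r - q"
      using qr Suc.prems[of N] nat_dvd_not_less[of "r - q" n] by auto
    then show "Suc (q mod n) \<noteq> Suc (r mod n)"
      using qr(3) mod_eq_dvd_iff_nat[of q r n] by simp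
  qed
  have cardB: "card B = w N"
    unfolding B_def by (simp add: card_image[OF inj])
  have subB: "B \<subseteq> {1..n}"
    using n by (auto simp: B_def Suc_le_eq)
  have one: "card {q \<in> {S..<S + w N}. Suc (q mod n) = j} = of_bool (j \<in> B)" for j
  proof (cases "j \<in> B")
    case True
    then obtain q where q: "q \<in> {S..<S + w N}" "Suc (q mod n) = j" by (auto simp: B_def)
    then have "{q \<in> {S..<S + w N}. Suc (q mod n) = j} = {q}"
      using inj unfolding inj_on_def by blast
    then show ?thesis using True by simp
  next
    case False
    then have "{q \<in> {S..<S + w N}. Suc (q mod n) = j} = {}" by (auto simp: B_def)
    then show ?thesis using False by simp
  qed
  have "card {i. i < Suc N \<and> j \<in> (A(N := B)) i} = card {q. q < S + w N \<and> Suc (q mod n) = j}" for j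
  proof -
    have "{i. i < Suc N \<and> j \<in> (A(N := B)) i} = {i. i < N \<and> j \<in> A i} \<union> (if j \<in> B then {N} else {})"
      by (auto simp: less_Suc_eq)
    then have "card {i. i < Suc N \<and> j \<in> (A(N := B)) i} = card {i. i < N \<and> j \<in> A i} + of_bool (j \<in> B)"
      by simp
    moreover have split: "{q. q < S + w N \<and> Suc (q mod n) = j} =
        {q. q < S \<and> Suc (q mod n) = j} \<union> {q \<in> {S..<S + w N}. Suc (q mod n) = j}"
      by auto
    have "card {q. q < S + w N \<and> Suc (q mod n) = j} =
        card {q. q < S \<and> Suc (q mod n) = j} + card {q \<in> {S..<S + w N}. Suc (q mod n) = j}"
      unfolding split by (intro card_Un_disjoint) auto
    ultimately show ?thesis using cnt one by (simp add: S_def)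
  qed
  moreover have "(\<Sum>i<Suc N. w i) = S + w N" by (simp add: S_def)
  moreover have "\<forall>i<Suc N. (A(N := B)) i \<subseteq> {1..n} \<and> card ((A(N := B)) i) = w i"
    using A subB cardB by (simp add: less_Suc_eq)
  ultimately show ?case
    by (intro exI[of _ "A(N := B)"]) simp
qed

text \<open>Division with remainder: the quotient by n runs through 0, ..., s - 1.\<close>

lemma card_residue_class:
  assumes "r < n"
  shows "card {q. q < s * n \<and> q mod n = r} = (s :: nat)"
proof -
  have "bij_betw (\<lambda>i. i * n + r) {..<s} {q. q < s * n \<and> q mod n = r}"
  proof (rule bij_betw_byWitness[where f' = "\<lambda>q. q div n"])
    show "(\<lambda>i. i * n + r) ` {..<s} \<subseteq> {q. q < s * n \<and> q mod n = r}"
    proof clarsimp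
      fix i assume "i < s"
      then have "Suc i * n \<le> s * n" by (intro mult_le_mono1) simp
      then show "i * n + r < s * n \<and> r mod n = r" using assms by simp
    qed
  qed (use assms in \<open>auto simp: less_mult_imp_div_less\<close>)
  from bij_betw_same_card[OF this] show ?thesis by simp
qed

text \<open>A total size of s n means that the cyclic deal stops after exactly s complete rounds,
  and each round hands out every element once.\<close>

lemma balanced_sets:
  fixes w :: "nat \<Rightarrow> nat"
  assumes "n > 0" "\<And>i. i < N \<Longrightarrow> w i \<le> n" "(\<Sum>i<N. w i) = s * n"
  obtains A where "\<And>i. i < N \<Longrightarrow> A i \<subseteq> {1..n}" "\<And>i. i < N \<Longrightarrow> card (A i) = w i"
    "\<And>j. j \<in> {1..n} \<Longrightarrow> card {i. i < N \<and> j \<in> A i} = s"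
proof -
  obtain A where A: "\<forall>i<N. A i \<subseteq> {1..n} \<and> card (A i) = w i"
    and cnt: "\<forall>j. card {i. i < N \<and> j \<in> A i} = card {q. q < s * n \<and> Suc (q mod n) = j}"
    using round_robin[of n N w, OF assms(1,2)] unfolding assms(3) by blast
  have "card {i. i < N \<and> j \<in> A i} = s" if "j \<in> {1..n}" for j
  proof -
    have "{q. q < s * n \<and> Suc (q mod n) = j} = {q. q < s * n \<and> q mod n = j - 1}"
      using that by auto
    moreover have "j - 1 < n" using that unfolding atLeastAtMost_iff by linarith
    ultimately show ?thesis using cnt card_residue_class[of "j - 1" n s] by simp
  qed
  with A that show thesis by blast
qed

subsection \<open>The type-0 pmf of a balanced family\<close>

lemma pmf_map_pmf_of_set_lessThan:
  assumes "t > 0"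
  shows "pmf (map_pmf f (pmf_of_set {..<t :: nat})) y = real (card {i. i < t \<and> f i = y}) / real t"
proof -
  have "{..<t} \<inter> f -` {y} = {i. i < t \<and> f i = y}" by auto
  then show ?thesis using assms by (simp add: pmf_map measure_pmf_of_set lessThan_empty_iff)
qed

text \<open>
  The covering condition \<open>A_count\<close> is exactly what vanishing at the points \<open>c\<^sub>j\<close> demands.
\<close>

locale balanced_family =
  fixes d s t n :: nat and A :: "nat \<Rightarrow> nat set"
  assumes s_pos: "s > 0" and two_s_le: "2 * s \<le> t"
    and n_pos: "n > 0" and n_less: "n < d"
    and A_sub: "i < t - s \<Longrightarrow> A i \<subseteq> {1..n}"
    and A_count: "j \<in> {1..n} \<Longrightarrow> card {i. i < t - s \<and> j \<in> A i} = s"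
begin

definition fam_poly :: qpoly where
  "fam_poly = (\<Sum>i<t - s. varprod (A i)) - pconst (of_nat s) * varprod {1..n} - pconst (of_nat (t - 2 * s))"

lemma A_range:
  assumes "i < t - s" "k \<in> A i"
  shows "1 \<le> k" "k \<le> n" "k \<noteq> d"
  using A_sub[OF assms(1)] assms(2) n_less by auto

lemma A_sub_d: "i < t - s \<Longrightarrow> A i \<subseteq> {1..d - 1}"
  using A_sub[of i] n_less by fastforce

lemma A_sub_d': "i < t - s \<Longrightarrow> A i \<subseteq> {1..d}"
  using A_sub[of i] n_less by fastforce

lemma A_finite: "i < t - s \<Longrightarrow> finite (A i)"
  using A_sub finite_subset by blast

lemma peval_fam_poly:
  "peval x fam_poly = (\<Sum>i<t - s. \<Prod>k\<in>A i. x k) - of_nat s * (\<Prod>k=1..n. x k) - of_nat (t - 2 * s)"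
proof -
  have "peval x (varprod (A i)) = (\<Prod>k\<in>A i. x k)" if "i < t - s" for i
    using peval_pconst_mult_varprod[OF A_finite[OF that], of x 1] by (simp add: pconst_1)
  moreover have "peval x (pconst a) = a" for a
    using peval_pconst_mult_varprod[of "{}" x a] by simp
  ultimately show ?thesis
    by (simp add: fam_poly_def peval_diff peval_sum peval_pconst_mult_varprod)
qed

lemma fam_poly_in_ideal: "fam_poly \<in> ideal_P d s t"
proof -
  have ring: "fam_poly \<in> poly_ring (d - 1)"
    unfolding fam_poly_def
  proof (intro poly_ring_diff poly_ring_sum)
    show "varprod (A i) \<in> poly_ring (d - 1)" if "i \<in> {..<t - s}" for i
      using poly_ring_pconst_mult_varprod[OF A_sub_d, of i 1] that by (simp add: pconst_1)
    show "pconst (of_nat s) * varprod {1..n} \<in> poly_ring (d - 1)"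
      using n_less by (intro poly_ring_pconst_mult_varprod) auto
    show "pconst (of_nat (t - 2 * s)) \<in> poly_ring (d - 1)"
      using poly_ring_pconst_mult_varprod[of "{}" "d - 1"] by simp
  qed
  have N: "(of_nat (t - s) :: rat) = of_nat t - of_nat s"
    "(of_nat (t - 2 * s) :: rat) = of_nat t - 2 * of_nat s"
    using two_s_le by (simp_all add: of_nat_diff)
  have one: "peval (\<lambda>_. 1) fam_poly = 0"
    by (simp add: peval_fam_poly N)
  have "peval (\<lambda>k. if k = j then - c_of s t else 1) fam_poly = 0" if "j \<in> {1..d - 1}" for j
  proof -
    let ?x = "\<lambda>k. if k = j then - c_of s t else 1"
    have pr: "(\<Prod>k\<in>B. ?x k) = 1 - (if j \<in> B then 1 + c_of s t else 0)" if "finite B" for B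
      using that by (simp add: prod.delta)
    have "(\<Sum>i<t - s. \<Prod>k\<in>A i. ?x k) = (\<Sum>i<t - s. 1 - (if j \<in> A i then 1 + c_of s t else 0))"
      by (intro sum.cong) (simp_all only: pr A_finite lessThan_iff)
    also have "\<dots> = of_nat (t - s) - of_nat (card {i. i < t - s \<and> j \<in> A i}) * (1 + c_of s t)"
      by (simp add: sum_subtractf sum.If_cases lessThan_def Int_def)
    also have "card {i. i < t - s \<and> j \<in> A i} = (if j \<in> {1..n} then s else 0)"
    proof (cases "j \<in> {1..n}")
      case False
      then have none: "{i. i < t - s \<and> j \<in> A i} = {}"
        using A_range(1,2) unfolding atLeastAtMost_iff by blast
      show ?thesis unfolding none by (simp only: False if_False card.empty)
    qed (use A_count in simp)
    finally have S: "(\<Sum>i<t - s. \<Prod>k\<in>A i. ?x k) =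
      of_nat (t - s) - of_nat (if j \<in> {1..n} then s else 0) * (1 + c_of s t)" .
    \<comment> \<open>For j \<le> n the multiples of 1 + c coming from the s sets containing j and
      from the monomial with coefficient -s cancel; what remains is the value at (1,...,1).\<close>
    show ?thesis
      unfolding peval_fam_poly S pr[OF finite_atLeastAtMost] N
      by (auto simp: algebra_simps)
  qed
  with ring one show ?thesis by (simp add: ideal_P_def)
qed

text \<open>The sets \<open>A i\<close> may repeat, be empty or equal {1..n}; the multiplicity and
  the two corrections collect equal monomials, as the type-0 recipe requires.\<close>

definition coef :: "nat \<Rightarrow> rat" where
  "coef j = of_nat (card {i. i < t - s \<and> A i = index_set j})
     - (if index_set j = {1..n} then of_nat s else 0)
     - (if index_set j = {} then of_nat (t - 2 * s) else 0)"

lemma coef_set_index: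
  assumes "B \<subseteq> {1..m}"
  shows "coef (set_index B) = of_nat (card {i. i < t - s \<and> A i = B})
     - (if B = {1..n} then of_nat s else 0) - (if B = {} then of_nat (t - 2 * s) else 0)"
  unfolding coef_def index_set_set_index[OF assms] ..

text \<open>Reindexed by subsets B of {1..d-1}, the sum meets each \<open>A i\<close>, {1..n} and
  the empty set exactly once; n < d ensures that {1..n} is among these subsets.\<close>

lemma fam_poly_expansion:
  "fam_poly = (\<Sum>j=1..2 ^ d div 2. pconst (coef j) * mono_j d j)"
proof -
  let ?M = "{1..d - 1}"
  have half: "2 ^ d div 2 = (2 ^ (d - 1) :: nat)"
    using n_less by (cases d) auto
  have "(\<Sum>j=1..2 ^ d div 2. pconst (coef j) * mono_j d j)
      = (\<Sum>j\<in>{1..2 ^ (d - 1)}. pconst (coef j) * varprod (index_set j))"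
    unfolding half by (intro sum.cong) (auto simp: mono_j_eq_varprod[unfolded One_nat_def])
  also have "\<dots> = (\<Sum>B\<in>Pow ?M. pconst (coef (set_index B)) * varprod (index_set (set_index B)))"
    by (rule sum.reindex_bij_betw[OF bij_betw_set_index, symmetric])
  also have "\<dots> = (\<Sum>B\<in>Pow ?M. (\<Sum>i<t - s. if A i = B then varprod (A i) else 0)
      - (if B = {1..n} then pconst (of_nat s) * varprod {1..n} else 0)
      - (if B = {} then pconst (of_nat (t - 2 * s)) else 0))"
  proof (intro sum.cong refl)
    fix B assume "B \<in> Pow ?M"
    then have B: "B \<subseteq> ?M" by simp
    have "(\<Sum>i<t - s. if A i = B then varprod (A i) else 0) = (\<Sum>i<t - s. if A i = B then varprod B else 0)"
      by (intro sum.cong) auto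
    also have "\<dots> = of_nat (card {i. i < t - s \<and> A i = B}) * varprod B"
      by (simp add: sum.If_cases lessThan_def Int_def)
    finally show "pconst (coef (set_index B)) * varprod (index_set (set_index B)) =
      (\<Sum>i<t - s. if A i = B then varprod (A i) else 0)
      - (if B = {1..n} then pconst (of_nat s) * varprod {1..n} else 0)
      - (if B = {} then pconst (of_nat (t - 2 * s)) else 0)"
      unfolding coef_set_index[OF B] index_set_set_index[OF B]
      using n_pos by (auto simp: pconst_diff pconst_of_nat pconst_0 left_diff_distrib)
  qed
  also have "\<dots> = (\<Sum>i<t - s. \<Sum>B\<in>Pow ?M. if A i = B then varprod (A i) else 0)
      - pconst (of_nat s) * varprod {1..n} - pconst (of_nat (t - 2 * s))"
  proof -
    have "{1..n} \<in> Pow ?M" "{} \<in> Pow ?M" using n_less by auto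
    then show ?thesis
      by (simp only: sum_subtractf sum.delta finite_Pow_iff finite_atLeastAtMost if_True
          sum.swap[of _ "{..<t - s}"])
  qed
  also have "(\<Sum>i<t - s. \<Sum>B\<in>Pow ?M. if A i = B then varprod (A i) else 0) = (\<Sum>i<t - s. varprod (A i))"
    by (intro sum.cong) (use A_sub_d in \<open>simp_all add: sum.delta'\<close>)
  finally show ?thesis by (simp add: fam_poly_def)
qed

text \<open>
  The negative monomial contributes \<open>s\<close> copies of the complement of \<open>{1..n}\<close>; this complement
  contains \<open>d\<close>, which no \<open>A i\<close> does.
\<close>

definition pts :: "nat \<Rightarrow> nat set" where
  "pts i = (if i < t - s then A i else {Suc n..d})"

lemma pts_sub: "pts i \<subseteq> {1..d}"
  using A_sub_d'[of i] by (simp add: pts_def)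

lemma d_mem_pts_iff: "d \<in> pts i \<longleftrightarrow> \<not> i < t - s"
  using n_less A_range(3)[of i d] by (auto simp: pts_def)

text \<open>The index is drawn uniformly, not the set, so that repeated points accumulate
  mass.\<close>

definition fam_pmf :: "(nat \<Rightarrow> nat) pmf" where
  "fam_pmf = map_pmf (\<lambda>i. ind_vec d (pts i)) (pmf_of_set {..<t})"

lemma t_pos: "t > 0"
  using s_pos two_s_le by simp

section \<open>Marginals of the uniform distribution on the family, and the support of its
  sum\<close>

lemma set_fam_pmf: "set_pmf fam_pmf = (\<lambda>i. ind_vec d (pts i)) ` {..<t}"
  using t_pos by (simp add: fam_pmf_def set_pmf_of_set lessThan_empty_iff)

lemma pmf_fam_pmf:
  assumes "B \<subseteq> {1..d}"
  shows "pmf fam_pmf (ind_vec d B) = real (card {i. i < t \<and> pts i = B}) / real t"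
  unfolding fam_pmf_def pmf_map_pmf_of_set_lessThan[OF t_pos] by (simp add: ind_vec_inject[OF pts_sub assms])

text \<open>A coordinate k \<le> n occurs only in sets \<open>A i\<close>, where
  \<open>A_count\<close> applies; a coordinate k > n occurs only in the s copies of the complement.
  This is what gives every marginal the parameter s/t.\<close>

lemma card_pts:
  assumes "k \<in> {1..d}"
  shows "card {i. i < t \<and> k \<in> pts i} = s"
proof (cases "k \<in> {1..n}")
  case True
  then have "{i. i < t \<and> k \<in> pts i} = {i. i < t - s \<and> k \<in> A i}"
    by (auto simp: pts_def)
  then show ?thesis using A_count[OF True] by simp
next
  case False
  then have mem_iff: "k \<in> pts i \<longleftrightarrow> t - s \<le> i" for i
    using assms A_range(2)[of i k] by (auto simp: pts_def)
  have "{i. i < t \<and> k \<in> pts i} = {t - s..<t}"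
    unfolding mem_iff by auto
  then show ?thesis using two_s_le by simp
qed

lemma fam_pmf_in_class: "fam_pmf \<in> bernoulli_class d (real s / real t)"
proof -
  have "map_pmf (\<lambda>x. x k = 1) fam_pmf = bernoulli_pmf (real s / real t)" if k: "k \<in> {1..d}" for k
  proof -
    have le: "real s / real t \<le> 1" "0 \<le> real s / real t"
      using two_s_le t_pos by simp_all
    have "map_pmf (\<lambda>x. x k = 1) fam_pmf = map_pmf (\<lambda>i. k \<in> pts i) (pmf_of_set {..<t})"
      unfolding fam_pmf_def map_pmf_comp by (intro map_pmf_cong) (simp_all add: ind_vec_apply[OF k])
    also have "\<dots> = bernoulli_pmf (real s / real t)"
    proof (rule pmf_eqI)
      fix b :: bool
      have "card {i. i < t \<and> k \<notin> pts i} = t - s"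
      proof -
        have "{i. i < t \<and> k \<notin> pts i} = {..<t} - {i. i < t \<and> k \<in> pts i}" by auto
        then show ?thesis using card_pts[OF k] by (simp add: card_Diff_subset subset_iff)
      qed
      then show "pmf (map_pmf (\<lambda>i. k \<in> pts i) (pmf_of_set {..<t})) b = pmf (bernoulli_pmf (real s / real t)) b"
        using card_pts[OF k] le two_s_le t_pos
        by (cases b) (simp_all add: pmf_map_pmf_of_set_lessThan of_nat_diff field_simps)
    qed
    finally show ?thesis .
  qed
  then show ?thesis
    by (auto simp: bernoulli_class_def set_fam_pmf ind_vec_in_cube)
qed

lemma set_sum_fam_pmf:
  "set_pmf (sum_pmf d fam_pmf) = insert (d - n) ((\<lambda>i. card (A i)) ` {..<t - s})"
proof -
  have split: "{..<t} = {..<t - s} \<union> {t - s..<t}" "{t - s..<t} \<noteq> {}"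
    using s_pos two_s_le by auto
  have "set_pmf (sum_pmf d fam_pmf) = (\<lambda>i. card (pts i)) ` {..<t}"
    by (simp add: sum_pmf_def set_fam_pmf image_image sum_ind_vec[unfolded One_nat_def, OF pts_sub[unfolded One_nat_def]])
  also have "\<dots> = (\<lambda>i. card (A i)) ` {..<t - s} \<union> (\<lambda>i. d - n) ` {t - s..<t}"
    unfolding split(1) image_Un by (intro arg_cong2[of _ _ _ _ "(\<union>)"] image_cong) (auto simp: pts_def)
  finally show ?thesis using split(2) by auto
qed

text \<open>
  If all \<open>A i\<close> are smaller than \<open>{1..n}\<close>, nothing cancels the monomial \<open>- s x\<^sub>1 \<cdots> x\<^sub>n\<close>, so it is the
  only one with a negative coefficient beyond the constant.
\<close>

lemma type0_c0_coef:
  assumes small: "\<And>i. i < t - s \<Longrightarrow> card (A i) < n"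
  shows "type0_c0 d s t coef = of_nat (card {i. i < t - s \<and> A i = {}})"
proof -
  have A_ne: "A i \<noteq> {1..n}" if "i < t - s" for i
    using small[OF that] by auto
  then have no_top: "{i. i < t - s \<and> A i = {1..n}} = {}" by auto
  have half: "2 ^ d div 2 = (2 ^ (d - 1) :: nat)"
    using n_less by (cases d) auto
  have sub_n: "{1..n} \<subseteq> {1..d - 1}" using n_less by auto
  have set_index_n: "coef (set_index {1..n}) = - of_nat s"
    using n_pos by (simp only: coef_set_index[OF subset_refl] no_top) simp
  have top_gt_1: "set_index {1..n} \<noteq> 1"
    using set_index_inject[OF subset_refl, of "{}" n] n_pos by (auto simp: set_index_def)
  have neg: "{j. 2 \<le> j \<and> j \<le> 2 ^ d div 2 \<and> coef j < 0} = {set_index {1..n}}"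
  proof (intro equalityI subsetI)
    fix j assume j: "j \<in> {j. 2 \<le> j \<and> j \<le> 2 ^ d div 2 \<and> coef j < 0}"
    then have eq: "set_index (index_set j) = j" by (intro set_index_index_set) simp
    then have "index_set j \<noteq> {}" using j by (auto simp: set_index_def)
    then have "index_set j = {1..n}" using j by (auto simp: coef_def split: if_splits)
    then show "j \<in> {set_index {1..n}}" using eq by simp
  next
    fix j assume "j \<in> {set_index {1..n}}"
    then show "j \<in> {j. 2 \<le> j \<and> j \<le> 2 ^ d div 2 \<and> coef j < 0}"
      using set_index_n s_pos set_index_le[OF sub_n] set_index_ge[of "{1..n}"] top_gt_1 by (simp add: half)
  qed
  have "set_index {} = 1" by (simp add: set_index_def)
  then have coef_1: "coef (Suc 0) = of_nat (card {i. i < t - s \<and> A i = {}}) - of_nat (t - 2 * s)"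
    using coef_set_index[of "{}" 0] n_pos by simp
  \<comment> \<open>The only negative coefficient in the sum is -s, and (2s - t)/s times -s is t -
    2s, which cancels the constant -(t - 2s). What is left is a count, so c0 is nonnegative and
    position D receives no mass.\<close>
  show ?thesis
    unfolding type0_c0_def neg using s_pos two_s_le
    by (simp add: set_index_n[unfolded One_nat_def] coef_1 of_nat_diff field_simps)
qed

text \<open>In terms of B, index 1 is the empty set, index D the full set, and the half is decided
  by d \<in> B. Strictly between these extremes the entry is the positive part of the coefficient of
  B if d \<notin> B, and the negative part of the coefficient of its complement otherwise.\<close>

lemma type0_raw_coef:
  assumes small: "\<And>i. i < t - s \<Longrightarrow> card (A i) < n" and B: "B \<subseteq> {1..d}"
  shows "type0_raw d s t coef (set_index B) = of_nat (card {i. i < t \<and> pts i = B})"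
proof -
  let ?C = "{1..d} - B"
  have A_ne: "A i \<noteq> {1..n}" if "i < t - s" for i
    using small[OF that] by auto
  then have no_top: "{i. i < t - s \<and> A i = {1..n}} = {}" by auto
  have half: "2 ^ d div 2 = (2 ^ (d - 1) :: nat)" and Suc_d: "Suc (d - 1) = d"
    using n_less by (cases d; simp)+
  have le_half: "set_index B \<le> 2 ^ d div 2 \<longleftrightarrow> d \<notin> B"
    using set_index_le_half_iff[of B "d - 1"] B by (simp only: half Suc_d)
  have one_iff: "set_index B = 1 \<longleftrightarrow> B = {}"
    using set_index_inject[of B d "{}"] B by (simp add: set_index_def)
  have full_iff: "set_index B = 2 ^ d \<longleftrightarrow> B = {1..d}"
    using set_index_inject[OF B subset_refl] by (simp only: set_index_full)
  have compl: "2 ^ d + 1 - set_index B = set_index ?C"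
    using set_index_compl[OF B] by simp
  have c0: "type0_c0 d s t coef = of_nat (card {i. i < t - s \<and> A i = {}})"
    by (rule type0_c0_coef) (rule small)
  consider "B = {}" | "B = {1..d}" | "B \<noteq> {}" "d \<notin> B" | "B \<noteq> {1..d}" "d \<in> B" by blast
  then show ?thesis
  proof cases
    case 1
    have "{i. i < t \<and> pts i = {}} = {i. i < t - s \<and> A i = {}}"
      using n_less by (auto simp: pts_def)
    then show ?thesis
      using 1 c0 by (simp add: type0_raw_def Let_def set_index_def)
  next
    case 2
    \<comment> \<open>No point contains both 1 and d: the sets \<open>A i\<close> miss d, and the
      complement of {1..n} misses 1.\<close>
    have "1 \<notin> pts i" if "i < t" "d \<in> pts i" for i
      using that(2) n_pos unfolding d_mem_pts_iff by (simp add: pts_def)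
    moreover have "1 \<in> B" "d \<in> B"
      using 2 n_less by simp_all
    ultimately have none: "{i. i < t \<and> pts i = B} = {}"
      by blast
    have "set_index B = 2 ^ d" "set_index B \<noteq> 1"
      using full_iff one_iff 2 n_less by auto
    then have "type0_raw d s t coef (set_index B) = 0"
      unfolding type0_raw_def Let_def c0 by simp
    then show ?thesis unfolding none by simp
  next
    case 3
    have "pts i = B \<longleftrightarrow> i < t - s \<and> A i = B" for i
    proof (cases "i < t - s")
      case False
      then show ?thesis using 3 d_mem_pts_iff by blast
    qed (simp add: pts_def)
    then have eq: "{i. i < t \<and> pts i = B} = {i. i < t - s \<and> A i = B}"
      by auto
    have raw: "type0_raw d s t coef (set_index B) = (if coef (set_index B) \<ge> 0 then coef (set_index B) else 0)"
      using 3 one_iff full_iff le_half n_less by (auto simp: type0_raw_def Let_def)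
    \<comment> \<open>Among nonempty sets without d only {1..n} has a negative coefficient. There
      the entry is 0, and so is the count, because every \<open>A i\<close> is smaller than
      {1..n}.\<close>
    show ?thesis
    proof (cases "B = {1..n}")
      case True
      show ?thesis
        using n_pos s_pos unfolding raw eq coef_set_index[OF B] unfolding True no_top by simp
    next
      case False
      then show ?thesis
        using 3 unfolding raw eq coef_set_index[OF B] by simp
    qed
  next
    case 4
    \<comment> \<open>The constant term may be negative too, but it would be read at the empty
      complement, that is for the full set, which this case excludes.\<close>
    have ne: "?C \<noteq> {}" using 4(1) B by (metis Diff_eq_empty_iff subset_antisym)
    have no_A: "pts i \<noteq> B" if "i < t - s" for i
      using 4(2) that d_mem_pts_iff[of i] by metis
    have C_iff: "?C = {1..n} \<longleftrightarrow> B = {Suc n..d}"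
    proof
      assume "?C = {1..n}"
      then have "B = {1..d} - {1..n}" using B double_diff[of B "{1..d}" "{1..d}"] by simp
      then show "B = {Suc n..d}" by auto
    next
      assume "B = {Suc n..d}"
      then show "?C = {1..n}" using n_less by auto
    qed
    have cnt: "card {i. i < t \<and> pts i = B} = (if ?C = {1..n} then s else 0)"
    proof (cases "B = {Suc n..d}")
      case True
      have "{i. i < t \<and> pts i = B} = {t - s..<t}"
      proof (intro equalityI subsetI)
        fix i assume "i \<in> {i. i < t \<and> pts i = B}"
        then show "i \<in> {t - s..<t}" using no_A[of i] by (cases "i < t - s") simp_all
      qed (simp add: True pts_def)
      then show ?thesis using C_iff True two_s_le by simp
    next
      case False
      then have "pts i \<noteq> B" for i
        using no_A[of i] by (cases "i < t - s") (simp_all add: pts_def)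
      then have none: "{i. i < t \<and> pts i = B} = {}" by blast
      show ?thesis unfolding none using C_iff False by simp
    qed
    have "B \<noteq> {}" using 4 by blast
    then have raw: "type0_raw d s t coef (set_index B) = (if coef (set_index ?C) \<ge> 0 then 0 else - coef (set_index ?C))"
      using 4 one_iff full_iff le_half unfolding type0_raw_def Let_def compl by simp
    show ?thesis
    proof (cases "?C = {1..n}")
      case True
      have "coef (set_index ?C) = - of_nat s"
        unfolding coef_set_index[OF Diff_subset] unfolding True no_top using n_pos by simp
      then show ?thesis unfolding raw cnt using True s_pos by simp
    next
      case False
      then show ?thesis unfolding raw cnt coef_set_index[OF Diff_subset] using ne by simp
    qed
  qed
qed

text \<open>The unnormalized entries count the indices i < t according to the value of
  \<open>pts i\<close>. They therefore add up to t, and normalization divides by the same t as the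
  uniform distribution.\<close>

lemma fam_pmf_type0:
  assumes small: "\<And>i. i < t - s \<Longrightarrow> card (A i) < n"
  shows "is_type0_pmf d s t fam_poly fam_pmf"
  unfolding is_type0_pmf_def
proof (intro conjI exI[of _ coef] ballI)
  show "fam_poly \<in> ideal_P d s t" by (rule fam_poly_in_ideal)
  show "set_pmf fam_pmf \<subseteq> cube d" by (auto simp: set_fam_pmf ind_vec_in_cube)
  show "fam_poly = (\<Sum>j=1..2 ^ d div 2. pconst (coef j) * mono_j d j)"
    by (rule fam_poly_expansion)
  have "(\<Sum>j=1..2 ^ d. type0_raw d s t coef j) = (\<Sum>B\<in>Pow {1..d}. type0_raw d s t coef (set_index B))"
    by (rule sum.reindex_bij_betw[OF bij_betw_set_index, symmetric])
  also have "\<dots> = (\<Sum>B\<in>Pow {1..d}. of_nat (card {i. i < t \<and> pts i = B}))"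
    by (intro sum.cong) (simp_all add: type0_raw_coef[OF small])
  also have "\<dots> = of_nat (\<Sum>B\<in>Pow {1..d}. card {i \<in> {..<t}. pts i = B})"
    by simp
  also have "(\<Sum>B\<in>Pow {1..d}. card {i \<in> {..<t}. pts i = B}) = card {..<t}"
    using sum.group[of "{..<t}" "Pow {1..d}" pts "\<lambda>_. 1 :: nat"] pts_sub by (simp add: image_subset_iff)
  finally have total: "(\<Sum>j=1..2 ^ d. type0_raw d s t coef j) = of_nat t" by simp
  fix x assume "x \<in> cube d"
  then obtain B where B: "B \<subseteq> {1..d}" and x: "x = ind_vec d B"
    using cube_eq_ind_vec by (metis (no_types, lifting) mem_Collect_eq subsetI)
  have raw: "type0_raw d s t coef (set_index B) = of_nat (card {i. i < t \<and> pts i = B})"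
    by (rule type0_raw_coef[OF _ B]) (rule small)
  show "pmf fam_pmf x = of_rat (type0_vec d s t coef (point_index d x))"
    unfolding x point_index_ind_vec[OF B] type0_vec_def total raw pmf_fam_pmf[OF B]
    by (simp add: of_rat_divide)
qed

end

subsection \<open>Families with two set sizes\<close>

lemma sum_lessThan_add:
  "(\<Sum>i<h + k. f i) = (\<Sum>i<h. f i) + (\<Sum>i<k. f (h + i :: nat) :: 'a :: comm_monoid_add)"
  by (induction k) (simp_all add: add.assoc)

text \<open>All cases of the theorem are instances of this. The bounds on u and v are conditional
  because a size that no set has may exceed n: for p = 1/2 and odd d one gets n = \<open>jM\<close>
  < \<open>jm\<close> with k = 0.\<close>

lemma poly_S_exists:
  fixes a1 a2 :: int
  assumes "s > 0" "2 * s \<le> t" "n > 0" "n < d"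
    and hk: "h + k = t - s" and total: "h * u + k * v = s * n"
    and u: "h > 0 \<Longrightarrow> u \<le> n" and v: "k > 0 \<Longrightarrow> v \<le> n"
    and a1: "a1 = int (t - 2 * s)" and a2: "a2 = int s"
  shows "\<exists>\<alpha> \<beta>.
      (\<forall>i\<in>{1..h}. \<alpha> i \<in> cube (d - 1) \<and> weight (d - 1) (\<alpha> i) = u) \<and>
      (\<forall>i\<in>{1..k}. \<beta> i \<in> cube (d - 1) \<and> weight (d - 1) (\<beta> i) = v) \<and>
      poly_S d a1 a2 n h k \<alpha> \<beta> \<in> ideal_P d s t \<and>
      (u < n \<and> v < n \<longrightarrow>
        (\<exists>X \<in> bernoulli_class d (real s / real t).
           is_type0_pmf d s t (poly_S d a1 a2 n h k \<alpha> \<beta>) X \<and>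
           set_pmf (sum_pmf d X) =
             {d - n} \<union> (if h > 0 then {u} else {}) \<union> (if k > 0 then {v} else {})))"
proof -
  define w where "w i = (if i < h then u else v)" for i
  have w_le: "w i \<le> n" if "i < t - s" for i
    using that u v hk by (auto simp: w_def)
  have w_sum: "(\<Sum>i<t - s. w i) = s * n"
    unfolding hk[symmetric] sum_lessThan_add by (simp add: w_def total)
  obtain A where A: "\<And>i. i < t - s \<Longrightarrow> A i \<subseteq> {1..n}" "\<And>i. i < t - s \<Longrightarrow> card (A i) = w i"
    "\<And>j. j \<in> {1..n} \<Longrightarrow> card {i. i < t - s \<and> j \<in> A i} = s"
    using balanced_sets[OF \<open>n > 0\<close> w_le w_sum] by blast
  interpret balanced_family d s t n A
    using assms A by unfold_locales
  \<comment> \<open>Exponent vectors are numbered from 1 and the family from 0; the second group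
    occupies the places h, ..., h + k - 1.\<close>
  define \<alpha> where "\<alpha> i = ind_vec (d - 1) (A (i - 1))" for i
  define \<beta> where "\<beta> i = ind_vec (d - 1) (A (h + (i - 1)))" for i
  have \<alpha>: "\<alpha> i \<in> cube (d - 1) \<and> weight (d - 1) (\<alpha> i) = u" if "i \<in> {1..h}" for i
  proof -
    have "i - 1 < h" using that unfolding atLeastAtMost_iff by linarith
    then show ?thesis
      using A(2)[of "i - 1"] hk A_sub_d[of "i - 1"] by (simp add: \<alpha>_def ind_vec_in_cube weight_ind_vec w_def)
  qed
  have \<beta>: "\<beta> i \<in> cube (d - 1) \<and> weight (d - 1) (\<beta> i) = v" if "i \<in> {1..k}" for i
  proof -
    have "i - 1 < k" using that unfolding atLeastAtMost_iff by linarith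
    then show ?thesis
      using A(2)[of "h + (i - 1)"] hk A_sub_d[of "h + (i - 1)"]
      by (simp add: \<beta>_def ind_vec_in_cube weight_ind_vec w_def)
  qed
  have "xpow (d - 1) (ind_vec (d - 1) (A i)) = varprod (A i)" if "i < h + k" for i
    using that hk by (intro xpow_ind_vec A_sub_d) simp
  then have "(\<Sum>i=1..h. xpow (d - 1) (\<alpha> i)) = (\<Sum>i<h. varprod (A i))"
    "(\<Sum>i=1..k. xpow (d - 1) (\<beta> i)) = (\<Sum>i<k. varprod (A (h + i)))"
    unfolding \<alpha>_def \<beta>_def One_nat_def sum.atLeast1_atMost_eq by simp_all
  then have poly: "poly_S d a1 a2 n h k \<alpha> \<beta> = fam_poly"
    unfolding poly_S_def fam_poly_def hk[symmetric] sum_lessThan_add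
    by (simp add: a1 a2 pconst_of_nat)
  have "\<exists>X \<in> bernoulli_class d (real s / real t). is_type0_pmf d s t fam_poly X \<and>
      set_pmf (sum_pmf d X) = {d - n} \<union> (if h > 0 then {u} else {}) \<union> (if k > 0 then {v} else {})"
    if "u < n \<and> v < n"
  proof (intro bexI[of _ fam_pmf] conjI fam_pmf_in_class)
    show "is_type0_pmf d s t fam_poly fam_pmf"
      using that A(2) by (intro fam_pmf_type0) (simp add: w_def)
    have split: "{..<t - s} = {..<h} \<union> {h..<h + k}"
      unfolding hk[symmetric] by auto
    have "(\<lambda>i. card (A i)) ` {..<t - s} = w ` {..<t - s}"
      using A(2) by simp
    also have "\<dots> = (\<lambda>_. u) ` {..<h} \<union> (\<lambda>_. v) ` {h..<h + k}"
      unfolding split image_Un by (intro arg_cong2[of _ _ _ _ "(\<union>)"] image_cong) (auto simp: w_def)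
    also have "\<dots> = (if h > 0 then {u} else {}) \<union> (if k > 0 then {v} else {})"
      by (simp add: image_constant_conv lessThan_empty_iff)
    finally show "set_pmf (sum_pmf d fam_pmf) =
        {d - n} \<union> (if h > 0 then {u} else {}) \<union> (if k > 0 then {v} else {})"
      unfolding set_sum_fam_pmf by (simp only: Un_insert_left Un_empty_left)
  qed
  then show ?thesis
    using \<alpha> \<beta> fam_poly_in_ideal unfolding poly[symmetric]
    by (intro exI[of _ \<alpha>] exI[of _ \<beta>]) blast
qed

text \<open>A nonintegral x lies strictly between its floor and the next integer, so the two strict
  neighbours are consecutive; x \<ge> 0 keeps the floor a natural number.\<close>

lemma Greatest_Least_around:
  fixes x :: real
  assumes "x \<ge> 0" "x \<notin> \<int>"
  shows "(GREATEST j::nat. real j < x) = nat \<lfloor>x\<rfloor>" "(LEAST j::nat. x < real j) = Suc (nat \<lfloor>x\<rfloor>)"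
    and "real (nat \<lfloor>x\<rfloor>) < x" "x < real (Suc (nat \<lfloor>x\<rfloor>))"
proof -
  have f: "real (nat \<lfloor>x\<rfloor>) = of_int \<lfloor>x\<rfloor>" using assms by simp
  show lo: "real (nat \<lfloor>x\<rfloor>) < x"
    unfolding f using assms by (metis Ints_of_int of_int_floor_le order_le_less)
  show hi: "x < real (Suc (nat \<lfloor>x\<rfloor>))"
    unfolding of_nat_Suc f by linarith
  show "(GREATEST j::nat. real j < x) = nat \<lfloor>x\<rfloor>"
    using lo hi by (intro Greatest_equality) linarith+
  show "(LEAST j::nat. x < real j) = Suc (nat \<lfloor>x\<rfloor>)"
    using lo hi by (intro Least_equality) linarith+
qed

section \<open>The choice of n, h and k in the three cases\<close>

theorem theorem5p1:
  fixes d s t jM jm :: nat and p :: real and a1 a2 :: int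
  assumes d: "d \<ge> 2"
    and s: "s > 0" and t: "t > 0"
    and p: "p = real s / real t" and p_le: "p \<le> 1 / 2"
    and half: "p = 1 / 2 \<Longrightarrow> s = 1 \<and> t = 2"
    and a1: "a1 = \<bar>2 * int s - int t\<bar>" and a2: "a2 = int s"
    and jM: "jM = (GREATEST j::nat. real j < p * real d)"
    and jm: "jm = (LEAST j::nat. p * real d < real j)"
  shows
    "(p * real d \<notin> \<int> \<longrightarrow>
       (p * real d + p < real jm \<and> jM \<ge> 1 \<longrightarrow>
         (\<exists>(h::nat) (k::nat) \<alpha> \<beta>.
            int k = a2 * int d - 2 * a2 * int jM - a1 * int jM \<and>
            int h = a1 + a2 - int k \<and>
            (\<forall>i\<in>{1..h}. \<alpha> i \<in> cube (d - 1) \<and> weight (d - 1) (\<alpha> i) = jM) \<and>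
            (\<forall>i\<in>{1..k}. \<beta> i \<in> cube (d - 1) \<and> weight (d - 1) (\<beta> i) = jm) \<and>
            poly_S d a1 a2 (d - jM) h k \<alpha> \<beta> \<in> ideal_P d s t \<and>
            (jm < d - jM \<longrightarrow>
              (\<exists>X \<in> bernoulli_class d p.
                 is_type0_pmf d s t (poly_S d a1 a2 (d - jM) h k \<alpha> \<beta>) X \<and>
                 set_pmf (sum_pmf d X) = {jM, jm})))) \<and>
       (p * real d + p \<ge> real jm \<longrightarrow>
         (\<exists>(h::nat) (k::nat) \<alpha> \<beta>.
            int k = a2 * int d - 2 * a2 * int jM - a1 * int jM - a2 \<and>
            int h = a1 + a2 - int k \<and>
            (\<forall>i\<in>{1..h}. \<alpha> i \<in> cube (d - 1) \<and> weight (d - 1) (\<alpha> i) = jM) \<and>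
            (\<forall>i\<in>{1..k}. \<beta> i \<in> cube (d - 1) \<and> weight (d - 1) (\<beta> i) = jm) \<and>
            poly_S d a1 a2 (d - jm) h k \<alpha> \<beta> \<in> ideal_P d s t \<and>
            (jm < d - jm \<longrightarrow>
              (\<exists>X \<in> bernoulli_class d p.
                 is_type0_pmf d s t (poly_S d a1 a2 (d - jm) h k \<alpha> \<beta>) X \<and>
                 set_pmf (sum_pmf d X) = {jM, jm}))))) \<and>
     (\<forall>m::nat. p * real d = real m \<longrightarrow>
       (\<exists>(h::nat) \<alpha>.
          int h = a1 + a2 \<and>
          (\<forall>i\<in>{1..h}. \<alpha> i \<in> cube (d - 1) \<and> weight (d - 1) (\<alpha> i) = m) \<and>
          poly_S d a1 a2 (d - m) h 0 \<alpha> \<alpha> \<in> ideal_P d s t \<and>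
          (m < d - m \<longrightarrow>
            (\<exists>X \<in> bernoulli_class d p.
               is_type0_pmf d s t (poly_S d a1 a2 (d - m) h 0 \<alpha> \<alpha>) X \<and>
               set_pmf (sum_pmf d X) = {m}))))"
proof -
  have two_s: "2 * s \<le> t"
  proof -
    have "real (2 * s) \<le> real t" using p_le t unfolding p by (simp add: field_simps)
    then show ?thesis by linarith
  qed
  have a1': "a1 = int (t - 2 * s)" using a1 two_s by simp
  \<comment> \<open>Multiplying by t turns comparisons of p d with integers into comparisons of
    natural numbers.\<close>
  have pd: "p * real d * real t = real (s * d)" using p t by simp
  show ?thesis
  proof (intro conjI impI allI)
    assume nonint: "p * real d \<notin> \<int>"
    have "p * real d \<ge> 0" using p by simp
    note GL = Greatest_Least_around[OF this nonint]
    have jm_Suc: "jm = Suc jM" using GL jM jm by simp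
    have lo: "jM * t < s * d"
    proof -
      have "real jM < p * real d" using GL jM by simp
      then have "real jM * real t < p * real d * real t" using t by simp
      then show ?thesis unfolding pd of_nat_mult[symmetric] of_nat_less_iff .
    qed
    have hi: "s * d < Suc jM * t"
    proof -
      have "p * real d < real (Suc jM)" using GL jM by simp
      then have "p * real d * real t < real (Suc jM) * real t" using t by (intro mult_strict_right_mono) simp_all
      then show ?thesis unfolding pd of_nat_mult[symmetric] of_nat_less_iff .
    qed
    have two_jM: "2 * jM < d"
    proof (rule ccontr)
      assume "\<not> 2 * jM < d"
      then have "s * d \<le> s * (2 * jM)" by simp
      also have "\<dots> \<le> jM * t" using mult_le_mono2[OF two_s, of jM] by (simp add: algebra_simps)
      finally show False using lo by simp
    qed
    have pd_p: "(p * real d + p) * real t = real (s * d + s)"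
      using p t by (simp add: field_simps)
    {
      assume case_a: "p * real d + p < real jm \<and> jM \<ge> 1"
      have le: "s * d + s < Suc jM * t"
      proof -
        have "(p * real d + p) * real t < real (Suc jM) * real t"
          using case_a t jm_Suc by (intro mult_strict_right_mono) simp_all
        then show ?thesis unfolding pd_p of_nat_mult[symmetric] of_nat_less_iff .
      qed
      \<comment> \<open>The solution of h + k = t - s and h jM + k (jM + 1) = s (d - jM). With a1 =
        t - 2s and a2 = s it is the stated formula.\<close>
      define k where "k = s * d - jM * t"
      define h where "h = t - s - k"
      have k_int: "int k = int s * int d - int jM * int t"
        using lo by (simp add: k_def of_nat_diff)
      have "k < t - s" using le lo by (simp add: k_def)
      then have hk: "h + k = t - s" and h_int: "int h = int t - int s - int k"
        by (simp_all add: h_def of_nat_diff)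
      have k_pos: "k > 0" and h_pos: "h > 0" using lo \<open>k < t - s\<close> by (simp_all add: k_def h_def)
      have tot_int: "int (h * jM + k * jm) = int (s * (d - jM))"
        using two_jM by (simp add: h_int k_int jm_Suc of_nat_diff algebra_simps)
      have total: "h * jM + k * jm = s * (d - jM)"
        using tot_int by (simp only: of_nat_eq_iff)
      have ints: "int k = a2 * int d - 2 * a2 * int jM - a1 * int jM" "int h = a1 + a2 - int k"
        using two_s by (simp_all add: a1' a2 h_int k_int of_nat_diff algebra_simps)
      \<comment> \<open>Here jM \<ge> 1 yields n < d, and 2 jM < d makes room for size jM + 1 in
        {1..n}.\<close>
      have n: "d - jM > 0" "d - jM < d" and u: "jM \<le> d - jM" and v: "jm \<le> d - jM"
        using two_jM case_a jm_Suc by simp_all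
      from poly_S_exists[OF s two_s n hk total u v a1' a2, folded p]
      obtain \<alpha> \<beta> where \<alpha>\<beta>: "\<forall>i\<in>{1..h}. \<alpha> i \<in> cube (d - 1) \<and> weight (d - 1) (\<alpha> i) = jM"
        "\<forall>i\<in>{1..k}. \<beta> i \<in> cube (d - 1) \<and> weight (d - 1) (\<beta> i) = jm"
        "poly_S d a1 a2 (d - jM) h k \<alpha> \<beta> \<in> ideal_P d s t"
        "jM < d - jM \<and> jm < d - jM \<longrightarrow>
        (\<exists>X \<in> bernoulli_class d p.
           is_type0_pmf d s t (poly_S d a1 a2 (d - jM) h k \<alpha> \<beta>) X \<and>
           set_pmf (sum_pmf d X) = {d - (d - jM)} \<union> (if h > 0 then {jM} else {}) \<union> (if k > 0 then {jm} else {}))"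
        by blast
      have "{d - (d - jM)} \<union> (if h > 0 then {jM} else {}) \<union> (if k > 0 then {jm} else {}) = {jM, jm}"
        using k_pos h_pos two_jM by auto
      with \<alpha>\<beta>(4) jm_Suc have "jm < d - jM \<longrightarrow>
        (\<exists>X \<in> bernoulli_class d p.
           is_type0_pmf d s t (poly_S d a1 a2 (d - jM) h k \<alpha> \<beta>) X \<and>
           set_pmf (sum_pmf d X) = {jM, jm})" by auto
      with \<alpha>\<beta>(1-3) ints show "\<exists>(h::nat) (k::nat) \<alpha> \<beta>.
            int k = a2 * int d - 2 * a2 * int jM - a1 * int jM \<and>
            int h = a1 + a2 - int k \<and>
            (\<forall>i\<in>{1..h}. \<alpha> i \<in> cube (d - 1) \<and> weight (d - 1) (\<alpha> i) = jM) \<and>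
            (\<forall>i\<in>{1..k}. \<beta> i \<in> cube (d - 1) \<and> weight (d - 1) (\<beta> i) = jm) \<and>
            poly_S d a1 a2 (d - jM) h k \<alpha> \<beta> \<in> ideal_P d s t \<and>
            (jm < d - jM \<longrightarrow>
              (\<exists>X \<in> bernoulli_class d p.
                 is_type0_pmf d s t (poly_S d a1 a2 (d - jM) h k \<alpha> \<beta>) X \<and>
                 set_pmf (sum_pmf d X) = {jM, jm}))"
        by blast
    next
      assume case_b: "p * real d + p \<ge> real jm"
      have ge: "Suc jM * t \<le> s * d + s"
      proof -
        have "real (Suc jM) * real t \<le> (p * real d + p) * real t"
          using case_b t jm_Suc by (intro mult_right_mono) simp_all
        then show ?thesis unfolding pd_p of_nat_mult[symmetric] of_nat_le_iff .
      qed
      \<comment> \<open>Now n = d - jm, so the right-hand side of the size equation, and with it k,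
        drops by s.\<close>
      define k where "k = s * d - jM * t - s"
      define h where "h = t - s - k"
      \<comment> \<open>Since s \<le> t - s, the case assumption still leaves p d - p \<ge> jM, so
        the subtractions defining k are not truncated.\<close>
      have ge': "jM * t + s \<le> s * d" using ge two_s by simp
      have k_int: "int k = int s * int d - int jM * int t - int s"
        using ge' by (simp add: k_def of_nat_diff)
      have "k < t - s" using hi ge' by (simp add: k_def)
      then have hk: "h + k = t - s" and h_int: "int h = int t - int s - int k"
        by (simp_all add: h_def of_nat_diff)
      have h_pos: "h > 0" using \<open>k < t - s\<close> by (simp add: h_def)
      have jm_d: "jm < d" using two_jM jm_Suc d by simp
      \<comment> \<open>For d = 2 jM + 1 the set {1..n} has only jM elements and no set of size jm
        fits. But then p d \<le> jM + p, so none is asked for.\<close>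
      have k_0: "k = 0" if "d = 2 * jM + 1"
      proof -
        have "s * d \<le> jM * t + s"
          using mult_le_mono2[OF two_s, of jM] that by (simp add: algebra_simps)
        then show ?thesis by (simp add: k_def)
      qed
      have v: "jm \<le> d - jm" if "k > 0"
        using k_0 that two_jM jm_Suc by (cases "d = 2 * jM + 1") simp_all
      have d_jm: "int (d - jm) = int d - int jM - 1" and jm_int: "int jm = int jM + 1"
        using jm_d jm_Suc by linarith+
      have tot_int: "int (h * jM + k * jm) = int (s * (d - jm))"
        unfolding of_nat_add of_nat_mult d_jm jm_int h_int k_int
        by (simp add: algebra_simps)
      have total: "h * jM + k * jm = s * (d - jm)"
        using tot_int by (simp only: of_nat_eq_iff)
      have ints: "int k = a2 * int d - 2 * a2 * int jM - a1 * int jM - a2" "int h = a1 + a2 - int k"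
        using two_s by (simp_all add: a1' a2 h_int k_int of_nat_diff algebra_simps)
      have n: "d - jm > 0" "d - jm < d" and u: "jM \<le> d - jm"
        using two_jM jm_d jm_Suc by simp_all
      from poly_S_exists[OF s two_s n hk total u v a1' a2, folded p]
      obtain \<alpha> \<beta> where \<alpha>\<beta>: "\<forall>i\<in>{1..h}. \<alpha> i \<in> cube (d - 1) \<and> weight (d - 1) (\<alpha> i) = jM"
        "\<forall>i\<in>{1..k}. \<beta> i \<in> cube (d - 1) \<and> weight (d - 1) (\<beta> i) = jm"
        "poly_S d a1 a2 (d - jm) h k \<alpha> \<beta> \<in> ideal_P d s t"
        "jM < d - jm \<and> jm < d - jm \<longrightarrow>
        (\<exists>X \<in> bernoulli_class d p.
           is_type0_pmf d s t (poly_S d a1 a2 (d - jm) h k \<alpha> \<beta>) X \<and>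
           set_pmf (sum_pmf d X) = {d - (d - jm)} \<union> (if h > 0 then {jM} else {}) \<union> (if k > 0 then {jm} else {}))"
        by blast
      \<comment> \<open>The value jm is attained by the complement even if k = 0, so only h > 0 is
        needed to obtain both values.\<close>
      have "{d - (d - jm)} \<union> (if h > 0 then {jM} else {}) \<union> (if k > 0 then {jm} else {}) = {jM, jm}"
        using h_pos jm_d by auto
      with \<alpha>\<beta>(4) jm_Suc have "jm < d - jm \<longrightarrow>
        (\<exists>X \<in> bernoulli_class d p.
           is_type0_pmf d s t (poly_S d a1 a2 (d - jm) h k \<alpha> \<beta>) X \<and>
           set_pmf (sum_pmf d X) = {jM, jm})" by auto
      with \<alpha>\<beta>(1-3) ints show "\<exists>(h::nat) (k::nat) \<alpha> \<beta>.
            int k = a2 * int d - 2 * a2 * int jM - a1 * int jM - a2 \<and>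
            int h = a1 + a2 - int k \<and>
            (\<forall>i\<in>{1..h}. \<alpha> i \<in> cube (d - 1) \<and> weight (d - 1) (\<alpha> i) = jM) \<and>
            (\<forall>i\<in>{1..k}. \<beta> i \<in> cube (d - 1) \<and> weight (d - 1) (\<beta> i) = jm) \<and>
            poly_S d a1 a2 (d - jm) h k \<alpha> \<beta> \<in> ideal_P d s t \<and>
            (jm < d - jm \<longrightarrow>
              (\<exists>X \<in> bernoulli_class d p.
                 is_type0_pmf d s t (poly_S d a1 a2 (d - jm) h k \<alpha> \<beta>) X \<and>
                 set_pmf (sum_pmf d X) = {jM, jm}))"
        by blast
    }
  next
    fix m :: nat
    assume m: "p * real d = real m"
    have mt: "m * t = s * d"
    proof -
      have "real (m * t) = real (s * d)" using pd m by simp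
      then show ?thesis by (simp only: of_nat_eq_iff)
    qed
    have m_pos: "m > 0" using mt s d by (cases m) auto
    have two_m: "2 * m \<le> d"
    proof -
      have "s * (2 * m) \<le> s * d"
        using mult_le_mono2[OF two_s, of m] mt by (simp add: algebra_simps)
      then show ?thesis using s by simp
    qed
    define h where "h = t - s"
    have hk: "h + 0 = t - s" by (simp add: h_def)
    \<comment> \<open>With all sets of size m the size equation (t - s) m = s (d - m) is just t m =
      s d.\<close>
    have total: "h * m + 0 * m = s * (d - m)"
      using mt by (simp add: h_def diff_mult_distrib diff_mult_distrib2 mult.commute)
    have h_pos: "h > 0" using two_s s by (simp add: h_def)
    have n: "d - m > 0" "d - m < d" and u: "m \<le> d - m"
      using two_m m_pos d by simp_all
    from poly_S_exists[OF s two_s n hk total u u a1' a2, folded p]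
    obtain \<alpha> \<beta> where \<alpha>: "\<forall>i\<in>{1..h}. \<alpha> i \<in> cube (d - 1) \<and> weight (d - 1) (\<alpha> i) = m"
      "poly_S d a1 a2 (d - m) h 0 \<alpha> \<beta> \<in> ideal_P d s t"
      "m < d - m \<and> m < d - m \<longrightarrow>
        (\<exists>X \<in> bernoulli_class d p.
           is_type0_pmf d s t (poly_S d a1 a2 (d - m) h 0 \<alpha> \<beta>) X \<and>
           set_pmf (sum_pmf d X) = {d - (d - m)} \<union> (if h > 0 then {m} else {}) \<union> (if (0::nat) > 0 then {m} else {}))"
      by blast
    have supp: "{d - (d - m)} \<union> (if h > 0 then {m} else {}) \<union> (if (0::nat) > 0 then {m} else {}) = {m}"
      using h_pos two_m by auto
    \<comment> \<open>For k = 0 the second sum is empty, so the first family can fill the second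
      argument.\<close>
    have same: "poly_S d a1 a2 (d - m) h 0 \<alpha> \<beta> = poly_S d a1 a2 (d - m) h 0 \<alpha> \<alpha>"
      by (simp add: poly_S_def)
    have "int h = a1 + a2"
      using two_s by (simp add: h_def a1' a2 of_nat_diff)
    then show "\<exists>(h::nat) \<alpha>.
          int h = a1 + a2 \<and>
          (\<forall>i\<in>{1..h}. \<alpha> i \<in> cube (d - 1) \<and> weight (d - 1) (\<alpha> i) = m) \<and>
          poly_S d a1 a2 (d - m) h 0 \<alpha> \<alpha> \<in> ideal_P d s t \<and>
          (m < d - m \<longrightarrow>
            (\<exists>X \<in> bernoulli_class d p.
               is_type0_pmf d s t (poly_S d a1 a2 (d - m) h 0 \<alpha> \<alpha>) X \<and>
               set_pmf (sum_pmf d X) = {m}))"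
      using \<alpha>[unfolded same supp] by blast
  qed
qed

end
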